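(* Let $(H,g)$ be a real Hilbert space and let $H_{\mathbb{C}} = W^{+}\oplus W^{-}$ be an orthogonal polarization, with associated complex structure $J_W$ and associated bilinear form $\omega_W$ on $H_{\mathbb{C}}$. Then $J_W$ and $\omega_W$ restrict to $H$ (that is, $J_W(H)\subseteq H$ and $\omega_W$ is real-valued on $H\times H$), and $(g, J_W, \omega_W)$ is a compatible triple on $H$. Moreover, $W^{+}$ and $W^{-}$ are Lagrangian with respect to $\omega_W$.
   Context: Hilbert spaces are separable, possibly finite-dimensional. A strong inner product on a real Hilbert space $H$ is a continuous symmetric bilinear form $g$ with $g(v,v)\ge 0$ for all $v$ such that $\varphi_g:H\to H^*$, $\varphi_g(v)(w)=g(v,w)$, is a bounded linear bijection with bounded inverse. A strong symplectic form is a continuous anti-symmetric bilinear form $\omega$ such that $\varphi_\omega:H\to H^*$, $\varphi_\omega(v)(w)=\omega(v,w)$, is a bounded linear bijection with bounded inverse. A complex structure is a continuous linear map $J:H\to H$ with $J^2=-\mathrm{id}$. A compatible triple $(g,J,\omega)$ consists of a strong inner product, a complex structure and a strong symplectic form with $g(v,w)=\omega(v,Jw)$ for all $v,w\in H$. $H_{\mathbb{C}}=H\otimes_{\mathbb{R}}\mathbb{C}$ is the complexification and $\alpha:H_{\mathbb{C}}\to H_{\mathbb{C}}$ is the real-linear extension of $v\otimes\lambda\mapsto v\otimes\overline{\lambda}$; $H$ is identified with the set of $\alpha$-fixed vectors. The inner product $g$ is extended to $H_{\mathbb{C}}$ sesquilinearly (linear in the first entry, conjugate-linear in the second). An orthogonal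 polarization is an orthogonal (with respect to this extension) direct sum decomposition $H_{\mathbb{C}}=W^+\oplus W^-$ such that $\alpha(W^+)=W^-$. Let $P_W^\pm:H_{\mathbb{C}}\to W^\pm$ be the orthogonal projections. The associated complex structure is $J_W=i(P_W^+-P_W^-)$ and the associated complex-bilinear form on $H_{\mathbb{C}}$ is $\omega_W(v,w)=g(J_Wv,\alpha w)$ (so that $\omega_W(v,w)=g(J_Wv,w)$ for $v,w\in H$). A subspace $L\subset H_{\mathbb{C}}$ is isotropic with respect to $\omega_W$ if $\omega_W$ vanishes on $L\times L$; it is Lagrangian if it is isotropic and there is another isotropic subspace $L'$ with $H_{\mathbb{C}}=L\oplus L'$. *)

theory Defs
  imports "HOL-Analysis.Analysis"
begin

section \<open>Compatible triples on a real Hilbert space\<close>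

text \<open>The map from H to its continuous dual, v to b(v, -). The dual is the type of bounded
  linear functionals with the operator norm.\<close>

definition to_dual ::
    "('a::real_normed_vector \<Rightarrow> 'a \<Rightarrow> real) \<Rightarrow> 'a \<Rightarrow> ('a \<Rightarrow>\<^sub>L real)" where
  "to_dual b v = Blinfun (b v)"

definition strongly_nondegenerate :: "('a::real_normed_vector \<Rightarrow> 'a \<Rightarrow> real) \<Rightarrow> bool" where
  "strongly_nondegenerate b \<longleftrightarrow>
     bounded_linear (to_dual b) \<and> bij (to_dual b) \<and> bounded_linear (inv (to_dual b))"

definition strong_inner_product :: "('a::real_normed_vector \<Rightarrow> 'a \<Rightarrow> real) \<Rightarrow> bool" where
  "strong_inner_product g \<longleftrightarrow>
     bounded_bilinear g \<and> (\<forall>v w. g v w = g w v) \<and> (\<forall>v. g v v \<ge> 0) \<and> strongly_nondegenerate g"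

definition strong_symplectic_form :: "('a::real_normed_vector \<Rightarrow> 'a \<Rightarrow> real) \<Rightarrow> bool" where
  "strong_symplectic_form \<omega> \<longleftrightarrow>
     bounded_bilinear \<omega> \<and> (\<forall>v w. \<omega> v w = - \<omega> w v) \<and> strongly_nondegenerate \<omega>"

definition complex_structure :: "('a::real_normed_vector \<Rightarrow> 'a) \<Rightarrow> bool" where
  "complex_structure J \<longleftrightarrow> bounded_linear J \<and> (\<forall>v. J (J v) = - v)"

definition compatible_triple ::
    "('a::real_normed_vector \<Rightarrow> 'a \<Rightarrow> real) \<Rightarrow> ('a \<Rightarrow> 'a) \<Rightarrow> ('a \<Rightarrow> 'a \<Rightarrow> real) \<Rightarrow> bool" where
  "compatible_triple g J \<omega> \<longleftrightarrow>
     strong_inner_product g \<and> complex_structure J \<and> strong_symplectic_form \<omega> \<and>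
     (\<forall>v w. g v w = \<omega> v (J w))"


section \<open>Complexification\<close>

text \<open>The complexification is realised on pairs: (v, w) stands for \<open>v \<otimes> 1 + w \<otimes> \<i>\<close>.
  Addition, real scaling and topology are those of the product type; the lemmas
  below identify it with the tensor product of H and the complex numbers over the reals.\<close>

type_synonym 'a complexification = "'a \<times> 'a"

definition cscale :: "complex \<Rightarrow> 'a::real_vector complexification \<Rightarrow> 'a complexification" where
  "cscale c x = (Re c *\<^sub>R fst x - Im c *\<^sub>R snd x, Re c *\<^sub>R snd x + Im c *\<^sub>R fst x)"

definition tensor :: "'a::real_vector \<Rightarrow> complex \<Rightarrow> 'a complexification" where
  "tensor v c = (Re c *\<^sub>R v, Im c *\<^sub>R v)"

definition incl :: "'a::real_vector \<Rightarrow> 'a complexification" where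
  "incl v = tensor v 1"

definition conj_map :: "'a::real_vector complexification \<Rightarrow> 'a complexification" where
  "conj_map x = (fst x, - snd x)"

text \<open>Sesquilinear extension of the inner product: linear in the first entry,
  conjugate-linear in the second (see \<open>cinner_tensor\<close>).\<close>

definition cinner :: "'a::real_inner complexification \<Rightarrow> 'a complexification \<Rightarrow> complex" where
  "cinner x y =
     Complex (fst x \<bullet> fst y + snd x \<bullet> snd y) (snd x \<bullet> fst y - fst x \<bullet> snd y)"

interpretation complexification: vector_space cscale
  by unfold_locales (auto simp: cscale_def algebra_simps)

lemma cscale_of_real: "cscale (of_real r) x = r *\<^sub>R x"
  by (simp add: cscale_def prod_eq_iff)

lemma cscale_tensor: "cscale c (tensor v d) = tensor v (c * d)"
  by (simp add: cscale_def tensor_def algebra_simps)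

lemma bilinear_tensor: "bilinear tensor"
  by (auto simp: bilinear_def tensor_def algebra_simps intro!: linearI)

lemma complexification_eq_tensor: "x = tensor (fst x) 1 + tensor (snd x) \<i>"
  by (simp add: tensor_def prod_eq_iff)

lemma tensor_universal:
  fixes b :: "'a::real_vector \<Rightarrow> complex \<Rightarrow> 'b::real_vector"
  assumes "bilinear b"
  shows "\<exists>!f. linear f \<and> (\<forall>v c. f (tensor v c) = b v c)"
proof (rule ex1I)
  interpret l: linear "\<lambda>v. b v c" for c using assms by (simp add: bilinear_def)
  interpret r: linear "b v" for v using assms by (simp add: bilinear_def)
  let ?f = "\<lambda>x. b (fst x) 1 + b (snd x) \<i>"
  have "?f (tensor v c) = b v c" for v c
  proof -
    have "b v c = b v (Re c *\<^sub>R 1 + Im c *\<^sub>R \<i>)"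
      by (rule arg_cong[where f = "b v"]) (simp add: complex_eq_iff)
    also have "\<dots> = ?f (tensor v c)"
      by (simp only: r.add r.scale) (simp add: tensor_def l.scale)
    finally show ?thesis by simp
  qed
  moreover have "linear ?f"
    by (rule linearI) (simp_all add: l.add l.scale algebra_simps)
  ultimately show "linear ?f \<and> (\<forall>v c. ?f (tensor v c) = b v c)" by blast
next
  fix f :: "'a complexification \<Rightarrow> 'b"
  assume f: "linear f \<and> (\<forall>v c. f (tensor v c) = b v c)"
  show "f = (\<lambda>x. b (fst x) 1 + b (snd x) \<i>)"
  proof
    fix x
    have "f x = f (tensor (fst x) 1 + tensor (snd x) \<i>)"
      using complexification_eq_tensor[of x] by simp
    also have "\<dots> = b (fst x) 1 + b (snd x) \<i>"
      using f by (simp add: linear_add)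
    finally show "f x = b (fst x) 1 + b (snd x) \<i>" .
  qed
qed

lemma linear_conj_map: "linear conj_map"
  by (rule linearI) (simp_all add: conj_map_def)

lemma conj_map_tensor: "conj_map (tensor v c) = tensor v (cnj c)"
  by (simp add: conj_map_def tensor_def)

lemma range_incl: "range incl = {x. conj_map x = x}"
proof -
  have "w = 0" if "- w = w" for w :: 'a
    using that by (simp add: neg_eq_iff_add_eq_0 flip: scaleR_2)
  then show ?thesis by (force simp: incl_def tensor_def conj_map_def)
qed

lemma inj_incl: "inj incl"
  by (simp add: inj_def incl_def tensor_def)

lemma cinner_tensor: "cinner (tensor v c) (tensor w d) = c * cnj d * of_real (v \<bullet> w)"
  by (simp add: cinner_def tensor_def complex_eq_iff algebra_simps)

lemma cinner_sesquilinear: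
  "cinner (x + y) z = cinner x z + cinner y z"
  "cinner x (y + z) = cinner x y + cinner x z"
  "cinner (cscale c x) y = c * cinner x y"
  "cinner x (cscale c y) = cnj c * cinner x y"
  by (simp_all add: cinner_def cscale_def complex_eq_iff algebra_simps)

lemma cinner_self: "cinner x x = of_real ((norm x)\<^sup>2)"
  by (simp add: cinner_def complex_eq_iff inner_commute norm_prod_def power2_norm_eq_inner)


section \<open>Orthogonal polarizations and Lagrangian subspaces\<close>

definition direct_sum_decomposition ::
    "'a::real_vector complexification set \<Rightarrow> 'a complexification set \<Rightarrow> bool" where
  "direct_sum_decomposition A B \<longleftrightarrow>
     complexification.subspace A \<and> complexification.subspace B \<and>
     A \<inter> B = {0} \<and> (\<forall>x. \<exists>a\<in>A. \<exists>b\<in>B. x = a + b)"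

text \<open>Closedness of the two summands need not be required: each is the orthogonal complement
  of the other.\<close>

definition orthogonal_polarization ::
    "'a::real_inner complexification set \<Rightarrow> 'a complexification set \<Rightarrow> bool" where
  "orthogonal_polarization Wp Wm \<longleftrightarrow>
     direct_sum_decomposition Wp Wm \<and> (\<forall>x\<in>Wp. \<forall>y\<in>Wm. cinner x y = 0) \<and> conj_map ` Wp = Wm"

definition orth_proj ::
    "'a::real_inner complexification set \<Rightarrow> 'a complexification \<Rightarrow> 'a complexification" where
  "orth_proj W x = (THE p. p \<in> W \<and> (\<forall>w\<in>W. cinner (x - p) w = 0))"

definition J_pol ::
    "'a::real_inner complexification set \<Rightarrow> 'a complexification set
      \<Rightarrow> 'a complexification \<Rightarrow> 'a complexification" where
  "J_pol Wp Wm x = cscale \<i> (orth_proj Wp x - orth_proj Wm x)"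

definition omega_pol ::
    "'a::real_inner complexification set \<Rightarrow> 'a complexification set
      \<Rightarrow> 'a complexification \<Rightarrow> 'a complexification \<Rightarrow> complex" where
  "omega_pol Wp Wm x y = cinner (J_pol Wp Wm x) (conj_map y)"

definition isotropic ::
    "('a::real_vector complexification \<Rightarrow> 'a complexification \<Rightarrow> complex)
      \<Rightarrow> 'a complexification set \<Rightarrow> bool" where
  "isotropic \<omega> L \<longleftrightarrow> complexification.subspace L \<and> (\<forall>x\<in>L. \<forall>y\<in>L. \<omega> x y = 0)"

definition lagrangian ::
    "('a::real_vector complexification \<Rightarrow> 'a complexification \<Rightarrow> complex)
      \<Rightarrow> 'a complexification set \<Rightarrow> bool" where
  "lagrangian \<omega> L \<longleftrightarrow>
     isotropic \<omega> L \<and> (\<exists>L'. isotropic \<omega> L' \<and> direct_sum_decomposition L L')"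

text \<open>Restrictions to H, identified with its image under \<open>incl\<close>. They are restrictions in the
  proper sense only if the operator preserves that image, respectively the form is real-valued
  on it; otherwise the values are meaningless.\<close>

definition restrict_op ::
    "('a::real_vector complexification \<Rightarrow> 'a complexification) \<Rightarrow> 'a \<Rightarrow> 'a" where
  "restrict_op T v = inv incl (T (incl v))"

definition restrict_form ::
    "('a::real_vector complexification \<Rightarrow> 'a complexification \<Rightarrow> complex)
      \<Rightarrow> 'a \<Rightarrow> 'a \<Rightarrow> real" where
  "restrict_form \<omega> v w = Re (\<omega> (incl v) (incl w))"

end

theory Submission
  imports Defs
begin

text \<open>
  Write a vector of the complexification as \<open>x = a + b\<close> along \<open>W\<^sup>+ \<oplus> W\<^sup>-\<close>. By orthogonality the
  projections are \<open>a\<close> and \<open>b\<close>, so \<open>J\<^sub>W\<close> acts as \<open>\<i>\<close> on \<open>W\<^sup>+\<close> and as \<open>-\<i>\<close> on \<open>W\<^sup>-\<close>. Hence \<open>J\<^sub>W\<close>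
  squares to \<open>-1\<close> and, by Pythagoras, preserves the norm. Conjugation swaps the summands and is
  conjugate-linear; the swap and the change from \<open>\<i>\<close> to \<open>-\<i>\<close> cancel, so \<open>J\<^sub>W\<close> commutes with
  conjugation and preserves its fixed space \<open>H\<close>.

  On \<open>H\<close> this leaves a linear isometry \<open>J\<close> with \<open>J\<^sup>2 = -1\<close>, and the restricted form is
  \<open>\<langle>J v, w\<rangle>\<close>. Everything required of a compatible triple is then formal, apart from strong
  nondegeneracy (lemma \<open>compatible_triple_isometric_complex_structure\<close>). There, completeness
  enters: the dual maps of the two forms are the Riesz map and the Riesz map composed with \<open>J\<close>.
  Both are isometric, and they are onto by the Riesz representation theorem, which is proved by
  minimising the energy \<open>\<parallel>x\<parallel>\<^sup>2/2 - f x\<close> (lemma \<open>riesz_representation\<close>).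

  Finally \<open>\<omega>\<^sub>W(x, y) = \<langle>J\<^sub>W x, conj y\<rangle>\<close> vanishes for \<open>x, y\<close> in the same summand, since \<open>J\<^sub>W\<close>
  preserves the summand and conjugation moves \<open>y\<close> to the orthogonal one; so the two summands are
  isotropic complements of each other.
\<close>


section \<open>The Riesz representation theorem\<close>

text \<open>The parallelogram law, in the form that turns a minimising sequence of the energy into a
  Cauchy sequence.\<close>

lemma energy_parallelogram:
  fixes f :: "'a::real_inner \<Rightarrow> real"
  assumes "linear f"
  defines "q \<equiv> \<lambda>x. (norm x)\<^sup>2 / 2 - f x"
  shows "(norm (x - y))\<^sup>2 / 4 = q x + q y - 2 * q ((1/2) *\<^sub>R (x + y))"
proof -
  interpret f: linear f by fact
  show ?thesis
    unfolding q_def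
    by (simp only: f.scale f.add power2_norm_eq_inner)
       (simp add: inner_add_left inner_add_right inner_diff_left inner_diff_right
         inner_commute[of y x] field_simps)
qed

text \<open>A minimiser \<open>u\<close> exists by completeness, and the vanishing of the first variation of the
  energy at \<open>u\<close> is the equation \<open>f y = \<langle>u, y\<rangle>\<close>.\<close>

lemma riesz_representation:
  fixes f :: "'a::{real_inner, complete_space} \<Rightarrow> real"
  assumes f: "bounded_linear f"
  obtains u where "\<And>y. f y = u \<bullet> y"
proof -
  interpret f: bounded_linear f by fact
  define q where "q = (\<lambda>x. (norm x)\<^sup>2 / 2 - f x)"
  obtain K where K: "\<And>x. norm (f x) \<le> norm x * K"
    using f.bounded by blast
  have below: "- (K\<^sup>2) / 2 \<le> q x" for x
  proof -
    have "f x \<le> norm x * K" using K[of x] by simp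
    moreover have "0 \<le> (norm x - K)\<^sup>2" by simp
    ultimately show ?thesis by (simp add: q_def power2_diff)
  qed
  define m where "m = Inf (range q)"
  have bdd: "bdd_below (range q)" using below by (rule bdd_belowI2)
  have m_le: "m \<le> q x" for x
    unfolding m_def by (rule cInf_lower[OF _ bdd]) simp
  have "\<exists>x. q x < m + 1 / real (Suc n)" for n
    using cInf_lessD[of "range q" "m + 1 / real (Suc n)"] by (auto simp: m_def)
  then obtain X where X: "\<And>n. q (X n) < m + 1 / real (Suc n)" by metis
  have "Cauchy X"
  proof (rule metric_CauchyI)
    fix e :: real assume "0 < e"
    \<comment> \<open>Two tails below \<open>e\<^sup>2/8\<close> add up to the \<open>e\<^sup>2/4\<close> on the left of the parallelogram law.\<close>
    then obtain N where N: "1 / real (Suc N) < e\<^sup>2 / 8"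
      using nat_approx_posE[of "e\<^sup>2 / 8"] by auto
    have "dist (X k) (X n) < e" if "k \<ge> N" "n \<ge> N" for k n
    proof -
      have tail: "1 / real (Suc i) < e\<^sup>2 / 8" if "i \<ge> N" for i
        by (rule le_less_trans[OF _ N]) (use that in \<open>simp add: frac_le\<close>)
      have "(norm (X k - X n))\<^sup>2 / 4 = q (X k) + q (X n) - 2 * q ((1/2) *\<^sub>R (X k + X n))"
        unfolding q_def by (rule energy_parallelogram) (rule f.linear_axioms)
      also have "\<dots> < 1 / real (Suc k) + 1 / real (Suc n)"
        using X[of k] X[of n] m_le[of "(1/2) *\<^sub>R (X k + X n)"] by linarith
      also have "\<dots> < e\<^sup>2 / 4" using tail[of k] tail[of n] that by linarith
      finally have "(norm (X k - X n))\<^sup>2 < e\<^sup>2" by simp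
      with \<open>0 < e\<close> show ?thesis by (simp add: dist_norm power_less_imp_less_base)
    qed
    then show "\<exists>N. \<forall>k\<ge>N. \<forall>n\<ge>N. dist (X k) (X n) < e" by blast
  qed
  then obtain u where u: "X \<longlonglongrightarrow> u" using Cauchy_convergent convergent_def by blast
  have "(\<lambda>n. q (X n)) \<longlonglongrightarrow> q u"
    unfolding q_def by (intro tendsto_intros f.tendsto u) simp
  moreover have "(\<lambda>n. m + 1 / real (Suc n)) \<longlonglongrightarrow> m + 0"
    by (intro tendsto_intros LIMSEQ_inverse_real_of_nat[unfolded inverse_eq_divide])
  ultimately have "q u \<le> m + 0"
    by (rule LIMSEQ_le) (use X in \<open>auto intro: less_imp_le\<close>)
  then have min: "q u \<le> q x" for x using m_le[of x] by simp
  have "f y = u \<bullet> y" for y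
  proof -
    define d where "d = u \<bullet> y - f y"
    have variation: "0 \<le> t * d + t\<^sup>2 * (y \<bullet> y) / 2" for t
      using min[of "u + t *\<^sub>R y"]
      unfolding q_def d_def power2_norm_eq_inner
      by (simp add: f.add f.scale inner_add_left inner_add_right inner_commute[of y u]
          field_simps power2_eq_square)
    have "d = 0"
    proof (rule ccontr)
      assume "d \<noteq> 0"
      \<comment> \<open>This \<open>t\<close> makes the linear term win; the summand 1 keeps it defined for \<open>y = 0\<close>.\<close>
      define t where "t = - d / (y \<bullet> y + 1)"
      have pos: "0 < y \<bullet> y + 1" by (simp add: add_nonneg_pos)
      have d: "d = - t * (y \<bullet> y + 1)" using pos by (simp add: t_def)
      have "0 < t\<^sup>2" using \<open>d \<noteq> 0\<close> pos by (simp add: t_def)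
      then have "0 < t\<^sup>2 * (y \<bullet> y / 2 + 1)" by (simp add: add_nonneg_pos)
      with variation[of t] show False unfolding d by (simp add: algebra_simps power2_eq_square)
    qed
    then show ?thesis by (simp add: d_def)
  qed
  then show ?thesis using that by blast
qed


section \<open>Compatible triples from isometric complex structures\<close>

lemma blinfun_apply_to_dual:
  assumes "bounded_bilinear b"
  shows "blinfun_apply (to_dual b v) = b v"
  unfolding to_dual_def
  by (rule bounded_linear_Blinfun_apply) (rule bounded_bilinear.bounded_linear_right[OF assms])

text \<open>The dual map is \<open>T\<close> followed by the Riesz map, hence an isometry onto the dual space; its
  inverse is again an isometry and so bounded.\<close>

lemma strongly_nondegenerate_isometry:
  fixes T :: "'a::{real_inner, complete_space} \<Rightarrow> 'a"
  assumes T: "bounded_linear T" and norm_T: "\<And>v. norm (T v) = norm v" and "surj T"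
  shows "strongly_nondegenerate (\<lambda>v w. T v \<bullet> w)"
proof -
  interpret T: bounded_linear T by fact
  let ?D = "to_dual (\<lambda>v w. T v \<bullet> w)"
  have apply_D: "blinfun_apply (?D v) w = T v \<bullet> w" for v w
    using blinfun_apply_to_dual[OF bounded_bilinear.comp1[OF bounded_bilinear_inner T]] by simp
  have lin: "linear ?D"
    by (intro linearI blinfun_eqI)
       (simp_all add: apply_D T.add T.scale blinfun.add_left blinfun.scaleR_left inner_add_left)
  have norm_D: "norm (?D v) = norm v" for v
  proof (rule antisym)
    show "norm (?D v) \<le> norm v"
      using Cauchy_Schwarz_ineq2[of "T v"] by (intro norm_blinfun_bound) (simp_all add: apply_D norm_T)
    have "norm v * norm v = \<bar>blinfun_apply (?D v) (T v)\<bar>"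
      using norm_T[of v] by (simp add: apply_D flip: power2_norm_eq_inner power2_eq_square)
    also have "\<dots> \<le> norm (?D v) * norm v"
      using norm_blinfun[of "?D v" "T v"] by (simp add: norm_T)
    finally show "norm v \<le> norm (?D v)"
      by (cases "v = 0") simp_all
  qed
  have "inj ?D"
    unfolding linear_injective_0[OF lin] by (metis norm_D norm_eq_zero)
  moreover have "surj ?D"
  proof -
    have "\<exists>v. ?D v = f" for f
    proof -
      obtain u where u: "\<And>y. blinfun_apply f y = u \<bullet> y"
        using riesz_representation[OF blinfun.bounded_linear_right] by blast
      obtain v where "T v = u" using \<open>surj T\<close> by (metis surjD)
      then have "?D v = f" by (intro blinfun_eqI) (simp add: apply_D u)
      then show ?thesis by blast
    qed
    then show ?thesis unfolding surj_def by metis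
  qed
  ultimately have bij: "bij ?D" by (simp add: bij_def)
  have D_inv: "?D (inv ?D f) = f" for f
    using bij by (simp add: bij_is_surj surj_f_inv_f)
  have "bounded_linear ?D"
    by (intro bounded_linear.intro lin bounded_linear_axioms.intro exI[of _ 1]) (simp add: norm_D)
  moreover have "bounded_linear (inv ?D)"
  proof (rule bounded_linear.intro)
    show "linear (inv ?D)"
      by (rule linearI; rule injD[OF \<open>inj ?D\<close>])
         (simp_all add: D_inv linear_add[OF lin] linear_scale[OF lin])
    show "bounded_linear_axioms (inv ?D)"
    proof (intro bounded_linear_axioms.intro exI[of _ 1] allI)
      show "norm (inv ?D f) \<le> norm f * 1" for f
        using norm_D[of "inv ?D f"] by (simp add: D_inv)
    qed
  qed
  ultimately show ?thesis using bij by (simp add: strongly_nondegenerate_def)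
qed

text \<open>Polarising \<open>\<parallel>J v\<parallel> = \<parallel>v\<parallel>\<close> shows that \<open>J\<close> preserves the inner product; with \<open>J\<^sup>2 = -1\<close> it is
  therefore skew, which makes \<open>\<langle>J v, w\<rangle>\<close> antisymmetric.\<close>

lemma compatible_triple_isometric_complex_structure:
  fixes J :: "'a::{real_inner, complete_space} \<Rightarrow> 'a"
  assumes lin: "linear J" and JJ: "\<And>v. J (J v) = - v" and norm_J: "\<And>v. norm (J v) = norm v"
  shows "compatible_triple inner J (\<lambda>v w. J v \<bullet> w)"
proof -
  interpret J: linear J by fact
  have J: "bounded_linear J"
    by (intro bounded_linear.intro lin bounded_linear_axioms.intro exI[of _ 1]) (simp add: norm_J)
  have inner_J: "J v \<bullet> J w = v \<bullet> w" for v w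
    using norm_J[of "v + w"] norm_J[of v] norm_J[of w] by (simp add: dot_norm J.add)
  have skew: "J v \<bullet> w = - (J w \<bullet> v)" for v w
    using inner_J[of "J v" w] by (simp add: JJ inner_commute[of v])
  have "surj J" by (rule surjI[of _ "\<lambda>v. - J v"]) (simp add: J.neg JJ)
  then have "strongly_nondegenerate (\<lambda>v w. J v \<bullet> w)"
    using J norm_J by (intro strongly_nondegenerate_isometry)
  moreover have "strongly_nondegenerate (inner :: 'a \<Rightarrow> 'a \<Rightarrow> real)"
    using strongly_nondegenerate_isometry[of "\<lambda>v::'a. v"] by (simp add: surj_def)
  moreover have "bounded_bilinear (\<lambda>v w. J v \<bullet> w)"
    by (rule bounded_bilinear.comp1[OF bounded_bilinear_inner J])
  ultimately show ?thesis
    unfolding compatible_triple_def strong_inner_product_def strong_symplectic_form_def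
      complex_structure_def
    by (intro conjI allI inner_commute skew) (simp_all add: J JJ bounded_bilinear_inner inner_J)
qed


section \<open>The operator of an orthogonal polarization\<close>

lemma cinner_commute: "cinner y x = cnj (cinner x y)"
  by (simp add: cinner_def complex_eq_iff inner_commute)

lemma conj_map_involution [simp]: "conj_map (conj_map x) = x"
  by (simp add: conj_map_def)

lemma norm_cscale_ii: "norm (cscale \<i> x) = norm x"
  by (simp add: cscale_def norm_prod_def add.commute)

lemma norm_diff_eq_norm_add_orthogonal:
  assumes "cinner a b = 0"
  shows "norm (a - b) = norm (a + b)"
proof -
  have "a \<bullet> b = 0" using assms by (simp add: cinner_def inner_prod_def complex_eq_iff)
  then show ?thesis
    by (simp add: norm_eq_sqrt_inner inner_diff_left inner_diff_right inner_add_left inner_add_right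
        inner_commute[of b a])
qed

text \<open>Only one point \<open>p\<close> of \<open>W\<close> qualifies as the projection: \<open>a - p\<close> both lies in \<open>W\<close> and is
  orthogonal to it.\<close>

lemma orth_proj_eqI:
  assumes W: "complexification.subspace W" and a: "a \<in> W" and b: "\<And>w. w \<in> W \<Longrightarrow> cinner b w = 0"
  shows "orth_proj W (a + b) = a"
  unfolding orth_proj_def
proof (rule the_equality)
  show "a \<in> W \<and> (\<forall>w\<in>W. cinner (a + b - a) w = 0)" using a b by simp
next
  fix p assume p: "p \<in> W \<and> (\<forall>w\<in>W. cinner (a + b - p) w = 0)"
  then have W_diff: "a - p \<in> W" using W a by (simp add: complexification.subspace_diff)
  have "cinner (a - p) (a - p) = cinner (a + b - p) (a - p) - cinner b (a - p)"
    using cinner_sesquilinear(1)[of "a - p" b "a - p"] by (simp add: algebra_simps)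
  also have "\<dots> = 0" using p b W_diff by simp
  finally show "p = a" by (simp add: cinner_self)
qed

context
  fixes Wp Wm :: "'a::real_inner complexification set"
  assumes pol: "orthogonal_polarization Wp Wm"
begin

lemma polarization_subspaces:
  "complexification.subspace Wp" "complexification.subspace Wm"
  using pol unfolding orthogonal_polarization_def direct_sum_decomposition_def by blast+

lemma polarization_orthogonal:
  assumes "a \<in> Wp" "b \<in> Wm"
  shows "cinner a b = 0" "cinner b a = 0"
proof -
  have "\<forall>x\<in>Wp. \<forall>y\<in>Wm. cinner x y = 0"
    using pol unfolding orthogonal_polarization_def by (elim conjE)
  then show "cinner a b = 0" using assms by (elim ballE) auto
  then show "cinner b a = 0" using cinner_commute[of b a] by simp
qed

lemma polarization_decompose:
  obtains a b where "a \<in> Wp" "b \<in> Wm" "x = a + b"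
proof -
  have "\<forall>x. \<exists>a\<in>Wp. \<exists>b\<in>Wm. x = a + b"
    using pol unfolding orthogonal_polarization_def direct_sum_decomposition_def by (elim conjE)
  then show ?thesis using that by (elim allE[of _ x] bexE)
qed

lemma conj_map_polarization:
  shows "a \<in> Wp \<Longrightarrow> conj_map a \<in> Wm" and "b \<in> Wm \<Longrightarrow> conj_map b \<in> Wp"
proof -
  have Wm: "Wm = conj_map ` Wp"
    using pol unfolding orthogonal_polarization_def by (elim conjE) (rule sym)
  show "a \<in> Wp \<Longrightarrow> conj_map a \<in> Wm" and "b \<in> Wm \<Longrightarrow> conj_map b \<in> Wp"
    unfolding Wm by auto
qed

lemma J_pol_decomposed:
  assumes "a \<in> Wp" "b \<in> Wm"
  shows "J_pol Wp Wm (a + b) = cscale \<i> (a - b)"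
proof -
  have "orth_proj Wp (a + b) = a" "orth_proj Wm (b + a) = b"
    by (rule orth_proj_eqI; simp add: assms polarization_subspaces polarization_orthogonal)+
  then show ?thesis
    by (simp add: J_pol_def add.commute)
qed

lemma J_pol_summands:
  shows "a \<in> Wp \<Longrightarrow> J_pol Wp Wm a = cscale \<i> a" and "b \<in> Wm \<Longrightarrow> J_pol Wp Wm b = cscale (- \<i>) b"
  using J_pol_decomposed[of a 0] J_pol_decomposed[of 0 b] polarization_subspaces
  by (simp_all add: complexification.subspace_0)

lemma J_pol_add: "J_pol Wp Wm (x + y) = J_pol Wp Wm x + J_pol Wp Wm y"
proof -
  obtain a b where x: "a \<in> Wp" "b \<in> Wm" "x = a + b" by (rule polarization_decompose)
  obtain a' b' where y: "a' \<in> Wp" "b' \<in> Wm" "y = a' + b'" by (rule polarization_decompose)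
  have "x + y = (a + a') + (b + b')" by (simp add: x y)
  moreover have "a + a' \<in> Wp" "b + b' \<in> Wm"
    using x y polarization_subspaces by (simp_all add: complexification.subspace_add)
  ultimately have "J_pol Wp Wm (x + y) = cscale \<i> ((a + a') - (b + b'))"
    by (simp only: J_pol_decomposed)
  also have "\<dots> = cscale \<i> (a - b) + cscale \<i> (a' - b')"
    by (simp only: add_diff_add complexification.scale_right_distrib)
  finally show ?thesis
    using x y by (simp add: J_pol_decomposed)
qed

lemma J_pol_cscale: "J_pol Wp Wm (cscale c x) = cscale c (J_pol Wp Wm x)"
proof -
  obtain a b where x: "a \<in> Wp" "b \<in> Wm" "x = a + b" by (rule polarization_decompose)
  have "J_pol Wp Wm (cscale c x) = J_pol Wp Wm (cscale c a + cscale c b)"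
    by (simp add: x complexification.scale_right_distrib)
  also have "\<dots> = cscale \<i> (cscale c a - cscale c b)"
    using x polarization_subspaces by (intro J_pol_decomposed complexification.subspace_scale)
  also have "\<dots> = cscale c (cscale \<i> (a - b))"
    by (simp add: mult.commute flip: complexification.scale_right_diff_distrib)
  finally show ?thesis using x by (simp add: J_pol_decomposed)
qed

lemma J_pol_J_pol: "J_pol Wp Wm (J_pol Wp Wm x) = - x"
proof -
  obtain a b where x: "a \<in> Wp" "b \<in> Wm" "x = a + b" by (rule polarization_decompose)
  have "- b \<in> Wm" using x polarization_subspaces by (simp add: complexification.subspace_neg)
  then have "J_pol Wp Wm (a - b) = cscale \<i> (a + b)"
    using J_pol_decomposed[of a "- b"] x by simp
  then show ?thesis using x by (simp add: J_pol_decomposed J_pol_cscale)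
qed

lemma norm_J_pol: "norm (J_pol Wp Wm x) = norm x"
proof -
  obtain a b where x: "a \<in> Wp" "b \<in> Wm" "x = a + b" by (rule polarization_decompose)
  then show ?thesis
    by (simp add: J_pol_decomposed norm_cscale_ii norm_diff_eq_norm_add_orthogonal
        polarization_orthogonal)
qed

text \<open>Conjugation exchanges the eigenspaces of \<open>J\<^sub>W\<close> as well as the eigenvalues \<open>\<i>\<close> and \<open>-\<i>\<close>.\<close>

lemma J_pol_conj_map: "J_pol Wp Wm (conj_map x) = conj_map (J_pol Wp Wm x)"
proof -
  obtain a b where x: "a \<in> Wp" "b \<in> Wm" "x = a + b" by (rule polarization_decompose)
  have conj: "conj_map b \<in> Wp" "conj_map a \<in> Wm" using x conj_map_polarization by auto
  have "J_pol Wp Wm (conj_map x) = J_pol Wp Wm (conj_map b + conj_map a)"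
    by (simp add: x linear_add[OF linear_conj_map] add.commute)
  also have "\<dots> = cscale \<i> (conj_map b - conj_map a)"
    by (rule J_pol_decomposed[OF conj])
  also have "\<dots> = conj_map (cscale \<i> (a - b))"
    by (simp add: conj_map_def cscale_def algebra_simps)
  also have "\<dots> = conj_map (J_pol Wp Wm x)" using x by (simp add: J_pol_decomposed)
  finally show ?thesis .
qed

lemma incl_restrict_op_J_pol: "incl (restrict_op (J_pol Wp Wm) v) = J_pol Wp Wm (incl v)"
proof -
  have "conj_map (incl v) = incl v" using range_incl by blast
  then have "J_pol Wp Wm (incl v) \<in> range incl"
    by (simp add: range_incl flip: J_pol_conj_map)
  then show ?thesis by (simp add: restrict_op_def f_inv_into_f)
qed

lemma linear_restrict_op_J_pol: "linear (restrict_op (J_pol Wp Wm))"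
proof (rule linearI; rule injD[OF inj_incl])
  have incl_add: "incl (v + w) = incl v + incl w" and incl_scale: "incl (r *\<^sub>R v) = cscale (of_real r) (incl v)"
    for v w :: 'a and r
    by (simp_all add: incl_def tensor_def cscale_def)
  fix v w :: 'a and r :: real
  show "incl (restrict_op (J_pol Wp Wm) (v + w))
      = incl (restrict_op (J_pol Wp Wm) v + restrict_op (J_pol Wp Wm) w)"
    by (simp add: incl_add incl_restrict_op_J_pol J_pol_add)
  show "incl (restrict_op (J_pol Wp Wm) (r *\<^sub>R v)) = incl (r *\<^sub>R restrict_op (J_pol Wp Wm) v)"
    by (simp add: incl_scale incl_restrict_op_J_pol J_pol_cscale)
qed

lemma omega_pol_incl:
  "omega_pol Wp Wm (incl v) (incl w) = of_real (restrict_op (J_pol Wp Wm) v \<bullet> w)"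
proof -
  have "conj_map (incl w) = incl w" using range_incl by blast
  then have "omega_pol Wp Wm (incl v) (incl w) = cinner (incl (restrict_op (J_pol Wp Wm) v)) (incl w)"
    by (simp add: omega_pol_def incl_restrict_op_J_pol)
  then show ?thesis by (simp add: incl_def cinner_tensor)
qed

lemma isotropic_polarization:
  "isotropic (omega_pol Wp Wm) Wp" "isotropic (omega_pol Wp Wm) Wm"
  unfolding isotropic_def omega_pol_def
  by (intro conjI ballI polarization_subspaces,
      simp add: J_pol_summands cinner_sesquilinear(3) polarization_orthogonal conj_map_polarization
        del: complexification.scale_minus_left)+

lemma lagrangian_polarization:
  "lagrangian (omega_pol Wp Wm) Wp" "lagrangian (omega_pol Wp Wm) Wm"
proof -
  have pm: "direct_sum_decomposition Wp Wm"
    using pol unfolding orthogonal_polarization_def by (elim conjE)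
  have mp: "direct_sum_decomposition Wm Wp"
    unfolding direct_sum_decomposition_def
  proof (intro conjI polarization_subspaces allI)
    show "Wm \<inter> Wp = {0}"
      using pm unfolding direct_sum_decomposition_def by (elim conjE) (subst Int_commute)
    show "\<exists>b\<in>Wm. \<exists>a\<in>Wp. x = b + a" for x
      by (rule polarization_decompose[of x]) (metis add.commute)
  qed
  show "lagrangian (omega_pol Wp Wm) Wp" "lagrangian (omega_pol Wp Wm) Wm"
    unfolding lagrangian_def using isotropic_polarization pm mp by blast+
qed

end


section \<open>The compatible triple of an orthogonal polarization\<close>

theorem proposition3p18:
  fixes Wp Wm :: "'a::{real_inner, polish_space} complexification set"
  assumes "orthogonal_polarization Wp Wm"
  shows "J_pol Wp Wm ` range incl \<subseteq> range incl \<and>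
         (\<forall>v w. omega_pol Wp Wm (incl v) (incl w) \<in> \<real>) \<and>
         compatible_triple (inner :: 'a \<Rightarrow> 'a \<Rightarrow> real)
           (restrict_op (J_pol Wp Wm)) (restrict_form (omega_pol Wp Wm)) \<and>
         lagrangian (omega_pol Wp Wm) Wp \<and>
         lagrangian (omega_pol Wp Wm) Wm"
proof (intro conjI allI)
  let ?J = "restrict_op (J_pol Wp Wm)"
  note incl_J = incl_restrict_op_J_pol[OF assms]
  show "J_pol Wp Wm ` range incl \<subseteq> range incl"
    by (auto simp flip: incl_J)
  show "omega_pol Wp Wm (incl v) (incl w) \<in> \<real>" for v w
    by (simp add: omega_pol_incl[OF assms])
  have incl_minus: "incl (- v) = - incl v" and norm_incl: "norm (incl v) = norm v" for v :: 'a
    by (simp_all add: incl_def tensor_def norm_prod_def)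
  have "?J (?J v) = - v" for v
    by (rule injD[OF inj_incl]) (simp add: incl_J J_pol_J_pol[OF assms] incl_minus)
  moreover have "norm (?J v) = norm v" for v
    using norm_J_pol[OF assms, of "incl v"] by (simp add: norm_incl flip: incl_J)
  ultimately have "compatible_triple inner ?J (\<lambda>v w. ?J v \<bullet> w)"
    using linear_restrict_op_J_pol[OF assms]
    by (intro compatible_triple_isometric_complex_structure)
  moreover have "restrict_form (omega_pol Wp Wm) = (\<lambda>v w. ?J v \<bullet> w)"
    by (simp add: restrict_form_def omega_pol_incl[OF assms] fun_eq_iff)
  ultimately show "compatible_triple inner ?J (restrict_form (omega_pol Wp Wm))" by simp
qed (fact lagrangian_polarization[OF assms])+

end
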